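(* There exists a collapsible simplicial $3$-ball $B$ such that for any facet $\sigma$ of the boundary $\partial B$, the ball $B$ does not collapse onto $\partial B-\sigma$.
   Context: All complexes are finite. A simplicial $3$-ball is a simplicial complex whose underlying space is homeomorphic to the $3$-ball. The facets of $\partial B$ are the boundary triangles; $\partial B-\sigma$ is $\partial B$ with only the face $\sigma$ removed (its edges and vertices are kept). Collapse: an elementary collapse removes from a complex a pair of faces $(\sigma,\Sigma)$ with $\dim\Sigma=\dim\sigma+1$, $\sigma$ a proper face of $\Sigma$ and of no other face. $C$ collapses onto $D$ if $D$ is obtained from $C$ by a finite sequence of elementary collapses; $C$ is collapsible if it collapses onto a single vertex. *)

theory Defs
  imports "HOL-Analysis.Analysis"
begin

text \<open>
  Finite simplicial complexes are given abstractly: a face is its set of vertices, its dimension is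
  one less than its cardinality, and the empty face is not listed. Unlike the geometric
  \<^const>\<open>simplicial_complex\<close>, this does not fix an ambient Euclidean space.
\<close>

definition finite_complex :: "'a set set \<Rightarrow> bool" where
  "finite_complex K \<longleftrightarrow>
     finite K \<and>
     (\<forall>\<sigma>\<in>K. finite \<sigma> \<and> \<sigma> \<noteq> {}) \<and>
     (\<forall>\<sigma>\<in>K. \<forall>\<tau>. \<tau> \<subseteq> \<sigma> \<and> \<tau> \<noteq> {} \<longrightarrow> \<tau> \<in> K)"

text \<open>
  Points are their families of barycentric coordinates. For a finite complex, the topology inherited
  from the product topology on functions is the usual topology of the underlying space.
\<close>

definition underlying_space :: "'a set set \<Rightarrow> ('a \<Rightarrow> real) set" where
  "underlying_space K =
     {x. (\<forall>v. 0 \<le> x v) \<and> {v. x v \<noteq> 0} \<in> K \<and> (\<Sum>v | x v \<noteq> 0. x v) = 1}"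

definition simplicial_3_ball :: "'a set set \<Rightarrow> bool" where
  "simplicial_3_ball B \<longleftrightarrow>
     finite_complex B \<and> underlying_space B homeomorphic (cball 0 1 :: (real ^ 3) set)"

definition facets :: "'a set set \<Rightarrow> 'a set set" where
  "facets K = {\<sigma> \<in> K. \<forall>\<tau>\<in>K. \<sigma> \<subseteq> \<tau> \<longrightarrow> \<tau> = \<sigma>}"

text \<open>
  The boundary of a simplicial 3-ball is the subcomplex generated by the triangles that lie in
  exactly one tetrahedron.
\<close>

definition boundary_complex :: "'a set set \<Rightarrow> 'a set set" where
  "boundary_complex B =
     {\<tau>. \<tau> \<noteq> {} \<and>
        (\<exists>\<sigma>\<in>B. \<tau> \<subseteq> \<sigma> \<and> card \<sigma> = 3 \<and> (\<exists>!T. T \<in> B \<and> card T = 4 \<and> \<sigma> \<subset> T))}"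

definition elementary_collapse :: "'a set set \<Rightarrow> 'a set set \<Rightarrow> bool" where
  "elementary_collapse C D \<longleftrightarrow>
     (\<exists>\<sigma>\<in>C. \<exists>T\<in>C.
        card T = card \<sigma> + 1 \<and> \<sigma> \<subset> T \<and>
        (\<forall>\<tau>\<in>C. \<sigma> \<subset> \<tau> \<longrightarrow> \<tau> = T) \<and>
        D = C - {\<sigma>, T})"

definition collapses_onto :: "'a set set \<Rightarrow> 'a set set \<Rightarrow> bool" where
  "collapses_onto = elementary_collapse\<^sup>*\<^sup>*"

definition collapsible :: "'a set set \<Rightarrow> bool" where
  "collapsible C \<longleftrightarrow> (\<exists>v. collapses_onto C {{v}})"

end

theory Submission imports Defs begin

text \<open>
  Let \<open>B\<close> be a ball with an interior edge \<open>e\<close> that is knotted as a trefoil together with an arc in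
  the boundary. If \<open>B\<close> collapsed onto its boundary minus a facet, then following the collapse would
  present the fundamental group of the complement of \<open>e\<close>, with generators dual to triangles and
  relators dual to edges, and the collapse would eliminate all generators except one, so the group
  would be cyclic; but the trefoil group maps onto \<open>S\<^sub>3\<close>. In terms of the threefold covering
  given by \<open>S\<^sub>3\<close> and branched over \<open>e\<close>: a sheet can be continued consistently over the
  tetrahedra as they are removed, all three sheets being available until \<open>e\<close> disappears and the
  sheet fixed by its monodromy afterwards. This gives a global section, although the covering is
  connected.

  The ball has 12 vertices and 36 tetrahedra. It is a ball because bistellar moves reduce it to a
  tetrahedron, and each move is a piecewise linear homeomorphism.
\<close>

subsection \<open>Complexes generated by facets\<close>

definition generated :: "'a set set \<Rightarrow> 'a set set" where
  "generated F = {\<tau>. \<tau> \<noteq> {} \<and> (\<exists>f\<in>F. \<tau> \<subseteq> f)}"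

lemma generated_singleton: "\<tau> \<in> generated {T} \<longleftrightarrow> \<tau> \<noteq> {} \<and> \<tau> \<subseteq> T"
  by (simp add: generated_def)

lemma finite_complex_generated:
  assumes "finite F" "\<And>f. f \<in> F \<Longrightarrow> finite f"
  shows "finite_complex (generated F)"
proof -
  have "generated F \<subseteq> Pow (\<Union>F)" by (auto simp: generated_def)
  moreover have "finite (Pow (\<Union>F))" using assms by auto
  ultimately have "finite (generated F)" by (rule finite_subset)
  moreover have "finite \<tau>" if "\<tau> \<in> generated F" for \<tau>
    using that assms(2) by (auto simp: generated_def intro: finite_subset)
  ultimately show ?thesis
    unfolding finite_complex_def generated_def by blast
qed

lemma homeomorphic_by_inverses:
  assumes "continuous_on A f" "continuous_on B g"
    and "\<And>x. x \<in> A \<Longrightarrow> f x \<in> B" "\<And>y. y \<in> B \<Longrightarrow> g y \<in> A"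
    and "\<And>x. x \<in> A \<Longrightarrow> g (f x) = x" "\<And>y. y \<in> B \<Longrightarrow> f (g y) = y"
  shows "A homeomorphic B"
proof -
  have "f ` A = B" "g ` B = A" using assms(3-6) by force+
  then show ?thesis
    using assms unfolding homeomorphic_def homeomorphism_def by blast
qed

subsection \<open>Bistellar moves\<close>

text \<open>Subtracting the minimum of the coordinates on \<open>s\<close> and spreading the lost mass evenly over
  \<open>t\<close> pushes a point out of the simplices through \<open>s\<close>; exchanging \<open>s\<close> and \<open>t\<close> undoes this when
  the minimum on \<open>t\<close> was zero.\<close>

definition slide :: "'a set \<Rightarrow> 'a set \<Rightarrow> ('a \<Rightarrow> real) \<Rightarrow> 'a \<Rightarrow> real" where
  "slide s t x v =
     (if v \<in> s then x v - Min (x ` s)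
      else if v \<in> t then x v + Min (x ` s) * real (card s) / real (card t)
      else x v)"

lemma continuous_on_Min_coordinates:
  fixes s :: "'a set"
  assumes "finite s" "s \<noteq> {}"
  shows "continuous_on S (\<lambda>x :: 'a \<Rightarrow> real. Min (x ` s))"
  using assms
proof (induction rule: finite_ne_induct)
  case (singleton v)
  then show ?case by (simp add: continuous_on_subset[OF continuous_on_product_coordinates])
next
  case (insert v s)
  then have "(\<lambda>x :: 'a \<Rightarrow> real. Min (x ` insert v s)) = (\<lambda>x. min (x v) (Min (x ` s)))"
    by auto
  then show ?case
    using insert by (auto intro!: continuous_on_min
        continuous_on_subset[OF continuous_on_product_coordinates])
qed

lemma continuous_on_slide:
  assumes "finite s" "s \<noteq> {}"
  shows "continuous_on S (slide s t)"
proof (rule continuous_on_coordinatewise_then_product)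
  fix v
  have c: "continuous_on S (\<lambda>x :: 'a \<Rightarrow> real. x v)"
    by (rule continuous_on_subset[OF continuous_on_product_coordinates]) simp
  note m = continuous_on_Min_coordinates[OF assms, of S]
  show "continuous_on S (\<lambda>x. slide s t x v)"
    unfolding slide_def
    by (cases "v \<in> s"; cases "v \<in> t")
       (auto simp: divide_inverse intro!: continuous_intros c m)
qed

text \<open>The two sides of a bistellar move: the facets through \<open>s\<close> form \<open>X * s * \<partial>t\<close> and are
  replaced by \<open>X * \<partial>s * t\<close>. A singleton \<open>s\<close> makes this the inverse of a stellar subdivision.\<close>

definition stellar_pair :: "'a set set \<Rightarrow> 'a set set \<Rightarrow> 'a set \<Rightarrow> 'a set \<Rightarrow> 'a set set" where
  "stellar_pair R X s t = R \<union> (\<Union>x\<in>X. (\<lambda>u. x \<union> s \<union> (t - {u})) ` t)"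

text \<open>The conditions on \<open>R\<close> say that \<open>s\<close> lies in no facet outside
  the replaced part and that \<open>t\<close> is not yet a face. They are symmetric in
  \<open>s\<close> and \<open>t\<close>, so the inverse move obeys the same lemmas.\<close>

locale bistellar_move =
  fixes R X :: "'a set set" and s t :: "'a set"
  assumes fin: "finite s" "finite t" and ne: "s \<noteq> {}" "t \<noteq> {}" and disj: "s \<inter> t = {}"
    and Xdisj: "\<And>x. x \<in> X \<Longrightarrow> x \<inter> (s \<union> t) = {}"
    and R: "\<And>r. r \<in> R \<Longrightarrow> \<not> s \<subseteq> r" "\<And>r. r \<in> R \<Longrightarrow> \<not> t \<subseteq> r"
    and finF: "\<And>f. f \<in> R \<union> X \<Longrightarrow> finite f"
begin

text \<open>No old face contains \<open>t\<close>, so some coordinate on \<open>t\<close> vanishes.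
  Sliding makes a coordinate on \<open>s\<close> vanish, which puts the support into the new
  complex; points over \<open>R\<close> do not move.\<close>

lemma slide_underlying_space:
  assumes x: "x \<in> underlying_space (generated (stellar_pair R X s t))"
  shows "slide s t x \<in> underlying_space (generated (stellar_pair R X t s))"
    and "Min (x ` t) = 0"
proof -
  define m where "m = Min (x ` s)"
  define y where "y = slide s t x"
  have nn: "0 \<le> x v" for v using x by (simp add: underlying_space_def)
  obtain f where f: "f \<in> stellar_pair R X s t" "{v. x v \<noteq> 0} \<subseteq> f"
    using x by (auto simp: underlying_space_def generated_def)
  have sum1: "(\<Sum>v | x v \<noteq> 0. x v) = 1" using x by (simp add: underlying_space_def)
  have "finite f" using f(1) finF fin by (auto simp: stellar_pair_def)
  then have fs: "finite {v. x v \<noteq> 0}" using f(2) finite_subset by blast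
  have mle: "m \<le> x v" if "v \<in> s" for v using that fin by (simp add: m_def)
  have m0: "0 \<le> m" using fin ne nn by (simp add: m_def)
  have "m \<in> x ` s" unfolding m_def using fin ne by (intro Min_in) auto
  then obtain w where w: "w \<in> s" "x w = m" by auto
  have "\<not> t \<subseteq> f"
  proof
    assume "t \<subseteq> f"
    with R(2) f(1) obtain z u where "z \<in> X" "u \<in> t" "t \<subseteq> z \<union> s \<union> (t - {u})"
      by (auto simp: stellar_pair_def)
    then show False using Xdisj[of z] disj by blast
  qed
  then obtain u where "u \<in> t" "x u = 0" using f(2) by blast
  then show "Min (x ` t) = 0" using fin nn by (intro Min_eqI) auto
  have yge: "0 \<le> y v" for v
    using nn[of v] m0 mle[of v] by (auto simp: y_def slide_def m_def[symmetric])
  have ysum: "(\<Sum>v | y v \<noteq> 0. y v) = 1"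
  proof -
    define A where "A = {v. x v \<noteq> 0} \<union> s \<union> t"
    have A: "finite A" using fs fin by (simp add: A_def)
    have "(\<Sum>v | y v \<noteq> 0. y v) = sum y A"
      by (rule sum.mono_neutral_left[OF A]) (auto simp: A_def y_def slide_def)
    also have "\<dots> = (\<Sum>v\<in>A. x v + ((if v \<in> s then - m else 0)
                     + (if v \<in> t then m * real (card s) / real (card t) else 0)))"
      using disj by (intro sum.cong) (auto simp: y_def slide_def m_def[symmetric])
    also have "\<dots> = sum x A + ((\<Sum>v\<in>s. - m) + (\<Sum>v\<in>t. m * real (card s) / real (card t)))"
    proof -
      have "A \<inter> {v. v \<in> s} = s" "A \<inter> {v. v \<in> t} = t" by (auto simp: A_def)
      then show ?thesis using A by (simp add: sum.distrib sum.If_cases)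
    qed
    also have "(\<Sum>v\<in>s. - m) + (\<Sum>v\<in>t. m * real (card s) / real (card t)) = 0"
      using fin ne by simp
    also have "sum x A = 1"
    proof -
      have "(\<Sum>v | x v \<noteq> 0. x v) = sum x A"
        by (rule sum.mono_neutral_left[OF A]) (auto simp: A_def)
      with sum1 show ?thesis by simp
    qed
    finally show ?thesis by simp
  qed
  have "{v. y v \<noteq> 0} \<noteq> {}" using ysum by (metis sum.empty zero_neq_one)
  moreover have "\<exists>f'\<in>stellar_pair R X t s. {v. y v \<noteq> 0} \<subseteq> f'"
  proof (cases "f \<in> R")
    case True
    then obtain v where "v \<in> s" "x v = 0" using R(1) f(2) by blast
    then have "m = 0" using mle m0 by fastforce
    then have "y = x" by (auto simp: y_def slide_def m_def[symmetric])
    then show ?thesis using True f(2) by (auto simp: stellar_pair_def)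
  next
    case False
    then obtain z u where z: "z \<in> X" "f = z \<union> s \<union> (t - {u})"
      using f(1) by (auto simp: stellar_pair_def)
    \<comment> \<open>The vertex \<open>w\<close> attains the minimum on \<open>s\<close>, so its
      coordinate drops to zero.\<close>
    have "y v = 0" if "v \<notin> z \<union> t \<union> (s - {w})" for v
      using that f(2) z(2) w by (cases "v \<in> s") (auto simp: y_def slide_def m_def[symmetric])
    then have "{v. y v \<noteq> 0} \<subseteq> z \<union> t \<union> (s - {w})" by blast
    moreover have "z \<union> t \<union> (s - {w}) \<in> stellar_pair R X t s"
      using z(1) w(1) by (auto simp: stellar_pair_def)
    ultimately show ?thesis by blast
  qed
  ultimately have "{v. y v \<noteq> 0} \<in> generated (stellar_pair R X t s)"
    by (simp add: generated_def)
  with yge ysum show "slide s t x \<in> underlying_space (generated (stellar_pair R X t s))"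
    unfolding y_def[symmetric] underlying_space_def by simp
qed

text \<open>As the minimum on \<open>t\<close> was zero, after the slide it is exactly the amount
  \<open>k\<close> added to each vertex of \<open>t\<close>, so the return slide takes away the same
  mass.\<close>

lemma slide_slide:
  assumes "Min (x ` t) = 0"
  shows "slide t s (slide s t x) = x"
proof -
  define k where "k = Min (x ` s) * real (card s) / real (card t)"
  have "slide s t x ` t = (\<lambda>r. r + k) ` (x ` t)"
    unfolding image_image using disj by (intro image_cong) (auto simp: slide_def k_def)
  moreover have "Min ((\<lambda>r. r + k) ` (x ` t)) = Min (x ` t) + k"
    using fin ne by (intro mono_Min_commute[symmetric]) (auto simp: mono_def)
  ultimately have "Min (slide s t x ` t) = k" using assms by simp
  then show ?thesis
    using disj fin ne by (auto simp: fun_eq_iff slide_def k_def)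
qed

lemma reverse: "bistellar_move R X t s"
  using fin ne disj Xdisj R finF by unfold_locales auto

lemma homeomorphic_stellar_pair:
  "underlying_space (generated (stellar_pair R X s t)) homeomorphic
   underlying_space (generated (stellar_pair R X t s))" (is "?A homeomorphic ?B")
proof (rule homeomorphic_by_inverses)
  interpret rev: bistellar_move R X t s by (rule reverse)
  show "slide s t x \<in> ?B" "slide t s (slide s t x) = x" if "x \<in> ?A" for x
    using slide_underlying_space[OF that] slide_slide by auto
  show "slide t s y \<in> ?A" "slide s t (slide t s y) = y" if "y \<in> ?B" for y
    using rev.slide_underlying_space[OF that] rev.slide_slide by auto
  show "continuous_on ?A (slide s t)" "continuous_on ?B (slide t s)"
    using fin ne by (simp_all add: continuous_on_slide)
qed

end

section \<open>A single simplex is a ball\<close>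

lemma simplex_homeomorphic_cball:
  assumes "finite T" "card T = DIM('b) + 1"
  shows "underlying_space (generated {T}) homeomorphic (cball 0 1 :: 'b::euclidean_space set)"
proof -
  \<comment> \<open>The coordinate at \<open>a\<close> is determined by the others, which are
    matched with the basis to give the standard simplex.\<close>
  obtain a T' where T: "T = insert a T'" "a \<notin> T'" "finite T'" "card T' = DIM('b)"
    using assms by (metis Suc_eq_plus1 card_Suc_eq_finite)
  then obtain h where h: "bij_betw h (Basis :: 'b set) T'"
    using finite_same_card_bij[of "Basis :: 'b set" T'] by auto
  define \<phi> where "\<phi> x = (\<Sum>b\<in>Basis. x (h b) *\<^sub>R b)" for x :: "'a \<Rightarrow> real"
  have \<phi>: "\<phi> x \<bullet> b = x (h b)" if "b \<in> Basis" for x and b :: 'b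
    using that by (simp add: \<phi>_def)
  let ?S = "convex hull (insert 0 (Basis :: 'b set))"
  define g where "g = inv_into (Basis :: 'b set) h"
  define \<psi> where "\<psi> y v = (if v = a then 1 - (\<Sum>b\<in>Basis. y \<bullet> b) else if v \<in> T' then y \<bullet> g v else 0)"
    for y :: 'b and v
  let ?U = "underlying_space (generated {T})"
  have U: "x \<in> ?U \<longleftrightarrow> (\<forall>v. 0 \<le> x v) \<and> (\<forall>v. v \<notin> T \<longrightarrow> x v = 0) \<and> sum x T = 1" for x
  proof -
    have "(\<Sum>v | x v \<noteq> 0. x v) = sum x T" if "{v. x v \<noteq> 0} \<subseteq> T"
      by (rule sum.mono_neutral_left) (use that assms in auto)
    moreover have "{v. x v \<noteq> 0} \<noteq> {}" if "sum x T = 1"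
      using that by (metis (mono_tags, lifting) Collect_empty_eq sum.neutral zero_neq_one)
    moreover have "(\<forall>v. v \<notin> T \<longrightarrow> x v = 0) \<longleftrightarrow> {v. x v \<noteq> 0} \<subseteq> T" by auto
    ultimately show ?thesis
      unfolding underlying_space_def mem_Collect_eq by (metis generated_singleton)
  qed
  have sumT: "sum x T = x a + (\<Sum>b\<in>Basis. x (h b))" for x :: "'a \<Rightarrow> real"
    using T sum.reindex_bij_betw[OF h, of x] by simp
  have hT: "h b \<in> T'" "g (h b) = b" if "b \<in> Basis" for b
    using h that by (auto simp: bij_betw_def g_def)
  have gT: "g v \<in> Basis" "h (g v) = v" if "v \<in> T'" for v
    using h that unfolding g_def by (metis bij_betw_def inv_into_into)
      (use h that in \<open>simp add: bij_betw_def f_inv_into_f\<close>)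
  have a: "h b \<noteq> a" if "b \<in> Basis" for b using hT(1)[OF that] T(2) by auto
  have "?U homeomorphic ?S"
    unfolding std_simplex
  proof (rule homeomorphic_by_inverses)
    let ?S = "{y::'b. (\<forall>i\<in>Basis. 0 \<le> y \<bullet> i) \<and> (\<Sum>i\<in>Basis. y \<bullet> i) \<le> 1}"
    show "\<phi> x \<in> ?S" if "x \<in> ?U" for x
    proof -
      have nn: "0 \<le> x v" for v using that by (simp add: U)
      have "x a + (\<Sum>b\<in>Basis. x (h b)) = 1" using that by (simp add: U sumT)
      then have "(\<Sum>b\<in>Basis. x (h b)) \<le> 1" using nn[of a] by linarith
      then show ?thesis using nn by (simp add: \<phi>)
    qed
    have \<psi>h: "\<psi> y (h b) = y \<bullet> b" if "b \<in> Basis" for y b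
      using hT[OF that] a[OF that] by (simp add: \<psi>_def)
    show "\<psi> y \<in> ?U" if "y \<in> ?S" for y
    proof -
      have "0 \<le> \<psi> y v" for v using that gT by (simp add: \<psi>_def)
      moreover have "\<psi> y v = 0" if "v \<notin> T" for v using that T(1) by (simp add: \<psi>_def)
      moreover have "\<psi> y a + (\<Sum>b\<in>Basis. \<psi> y (h b)) = 1"
        by (simp add: \<psi>h) (simp add: \<psi>_def)
      ultimately show ?thesis unfolding U sumT by blast
    qed
    show "\<psi> (\<phi> x) = x" if x: "x \<in> ?U" for x
    proof
      fix v
      have s: "x a + (\<Sum>b\<in>Basis. x (h b)) = 1" and z: "v \<notin> T \<Longrightarrow> x v = 0"
        using x unfolding U sumT by auto
      show "\<psi> (\<phi> x) v = x v"
        using s z gT[of v] T(1) by (auto simp: \<psi>_def \<phi>)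
    qed
    show "\<phi> (\<psi> y) = y" for y :: 'b
      by (rule euclidean_eqI) (simp add: \<phi> \<psi>h)
    have c: "continuous_on ?U (\<lambda>x :: 'a \<Rightarrow> real. x v)" for v
      by (rule continuous_on_subset[OF continuous_on_product_coordinates]) simp
    show "continuous_on ?U \<phi>" unfolding \<phi>_def by (intro continuous_intros c)
    show "continuous_on ?S \<psi>"
    proof (rule continuous_on_coordinatewise_then_product)
      fix v show "continuous_on ?S (\<lambda>y. \<psi> y v)"
        by (cases "v = a"; cases "v \<in> T'") (auto simp: \<psi>_def intro!: continuous_intros)
    qed
  qed
  also have "?S homeomorphic (cball 0 1 :: 'b set)"
    using interior_std_simplex_nonempty
    by (intro homeomorphic_convex_compact_cball) (auto simp: compact_convex_hull finite_imp_compact)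
  finally show ?thesis .
qed

subsection \<open>Branched coverings obstruct collapses\<close>

lemma collapses_onto_subset: "collapses_onto C D \<Longrightarrow> D \<subseteq> C"
  unfolding collapses_onto_def
  by (induction rule: rtranclp_induct) (auto simp: elementary_collapse_def)

definition boundary_triangle :: "'a set set \<Rightarrow> 'a set \<Rightarrow> bool" where
  "boundary_triangle B t \<longleftrightarrow> t \<in> B \<and> card t = 3 \<and> (\<exists>!T. T \<in> B \<and> card T = 4 \<and> t \<subset> T)"

lemma boundary_complex_iff:
  "\<tau> \<in> boundary_complex B \<longleftrightarrow> \<tau> \<noteq> {} \<and> (\<exists>t. boundary_triangle B t \<and> \<tau> \<subseteq> t)"
  unfolding boundary_complex_def boundary_triangle_def mem_Collect_eq Bex_def
  by (simp only: conj_ac)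

definition dual_adjacent :: "'a set set \<Rightarrow> 'a set \<Rightarrow> 'a set \<Rightarrow> bool" where
  "dual_adjacent B T U \<longleftrightarrow>
     T \<in> B \<and> U \<in> B \<and> card T = 4 \<and> card U = 4 \<and> T \<noteq> U \<and> card (T \<inter> U) = 3"

fun holonomy :: "('a set \<Rightarrow> nat \<Rightarrow> nat) \<Rightarrow> 'a set list \<Rightarrow> nat \<Rightarrow> nat" where
  "holonomy lab (T # U # p) i = holonomy lab (U # p) (lab (T \<inter> U) i)"
| "holonomy lab _ i = i"

text \<open>A section of the covering over the dual graph of the removed part. The function
  \<open>c\<close> is total, but a tetrahedron whose shared triangles are all still in
  \<open>C\<close> may take any sheet.\<close>

definition section_off :: "'a set set \<Rightarrow> ('a set \<Rightarrow> nat \<Rightarrow> nat) \<Rightarrow> 'a set set \<Rightarrow> ('a set \<Rightarrow> nat) \<Rightarrow> bool" where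
  "section_off B lab C c \<longleftrightarrow> (\<forall>T. c T < 3) \<and>
     (\<forall>T U. dual_adjacent B T U \<longrightarrow> T \<inter> U \<notin> C \<longrightarrow> c U = lab (T \<inter> U) (c T))"

lemma section_off_triangles_cong:
  assumes "section_off B lab C c" "\<And>t. card t = 3 \<Longrightarrow> t \<in> C \<Longrightarrow> t \<in> C'"
  shows "section_off B lab C' c"
proof -
  have "T \<inter> U \<notin> C" if "dual_adjacent B T U" "T \<inter> U \<notin> C'" for T U
    using assms(2) that by (auto simp: dual_adjacent_def)
  then show ?thesis using assms(1) unfolding section_off_def by blast
qed

lemma section_off_holonomy:
  assumes "section_off B lab C c" "p \<noteq> []"
    and "successively (\<lambda>T U. dual_adjacent B T U \<and> T \<inter> U \<notin> C) p"
  shows "c (last p) = holonomy lab p (c (hd p))"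
  using assms(2,3)
proof (induction p rule: induct_list012)
  case (3 T U p)
  then have "c U = lab (T \<inter> U) (c T)"
    using assms(1) unfolding section_off_def by simp
  with 3 show ?case by simp
qed auto

text \<open>\<open>B\<close> carries a branched threefold covering over the edge \<open>e\<close>, given by permutations \<open>lab\<close> of
  the three sheets on crossing a triangle: trivial monodromy around the other interior edges, a
  fixed sheet around \<open>e\<close>, and no sheet closing up along some dual loop.\<close>

locale branched_cover =
  fixes B :: "'a set set" and lab :: "'a set \<Rightarrow> nat \<Rightarrow> nat" and e :: "'a set"
  assumes complex: "finite_complex B"
    and lab: "i < 3 \<Longrightarrow> lab t i < 3" "i < 3 \<Longrightarrow> lab t (lab t i) = i"
    and pseudomanifold: "dual_adjacent B T U \<Longrightarrow> dual_adjacent B T V \<Longrightarrow> T \<inter> U = T \<inter> V \<Longrightarrow> U = V"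
    and interior_edge:
      "f \<in> B \<Longrightarrow> card f = 2 \<Longrightarrow> f \<notin> boundary_complex B \<Longrightarrow> dual_adjacent B T U \<Longrightarrow> f \<subset> T \<inter> U \<Longrightarrow>
       \<exists>p. p \<noteq> [] \<and> (hd p = T \<and> last p = U \<or> hd p = U \<and> last p = T) \<and>
         successively (\<lambda>P Q. dual_adjacent B P Q \<and> f \<subset> P \<inter> Q \<and> P \<inter> Q \<noteq> T \<inter> U) p \<and>
         (\<forall>i<3. f \<noteq> e \<longrightarrow> holonomy lab p i = lab (T \<inter> U) i) \<and>
         (\<exists>i<3. holonomy lab p i = lab (T \<inter> U) i)"
    and loop: "\<exists>p. p \<noteq> [] \<and> hd p = last p \<and> successively (dual_adjacent B) p \<and>
         (\<forall>i<3. holonomy lab p i \<noteq> i)"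
begin

lemma adj_sym: "dual_adjacent B T U \<Longrightarrow> dual_adjacent B U T"
  by (auto simp: dual_adjacent_def Int_commute)

lemma adj_inter_mem:
  assumes "dual_adjacent B T U"
  shows "T \<inter> U \<in> B"
proof -
  have "T \<in> B" "T \<inter> U \<subseteq> T" "T \<inter> U \<noteq> {}" using assms by (auto simp: dual_adjacent_def)
  then show ?thesis using complex unfolding finite_complex_def by blast
qed

lemma finite_face: "T \<in> B \<Longrightarrow> finite T"
  using complex by (auto simp: finite_complex_def)

lemma card_inter_le_3:
  assumes "T \<in> B" "P \<in> B" "card T = 4" "card P = 4" "P \<noteq> T"
  shows "card (T \<inter> P) \<le> 3"
proof -
  have "T \<inter> P \<noteq> T"
    using assms finite_face card_subset_eq[of P T] by auto
  then have "T \<inter> P \<subset> T" by blast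
  from psubset_card_mono[OF finite_face[OF assms(1)] this] assms(3) show ?thesis by simp
qed

text \<open>If \<open>P\<close> differs from \<open>T\<close>, then \<open>T \<inter> P\<close>
  contains the common triangle and has at most three vertices, so it is that triangle and
  \<open>pseudomanifold\<close> applies.\<close>

lemma adj_inter_unique:
  assumes "dual_adjacent B T U" "dual_adjacent B P Q" "T \<inter> U = P \<inter> Q"
  shows "P = T \<and> Q = U \<or> P = U \<and> Q = T"
proof (cases "P = T")
  case True
  with assms show ?thesis using pseudomanifold by metis
next
  case False
  have "T \<inter> U \<subseteq> T \<inter> P" using assms(3) by blast
  moreover have "card (T \<inter> P) \<le> 3"
    using False assms(1,2) by (intro card_inter_le_3) (auto simp: dual_adjacent_def)
  ultimately have eq: "T \<inter> U = T \<inter> P"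
    using assms(1) finite_face by (intro card_seteq) (auto simp: dual_adjacent_def)
  then have "dual_adjacent B T P" using assms(1,2) False by (auto simp: dual_adjacent_def)
  then have "P = U" using pseudomanifold assms(1) eq by metis
  moreover have "Q = T"
    using pseudomanifold[of U Q T] assms \<open>P = U\<close> adj_sym by (metis Int_commute)
  ultimately show ?thesis by simp
qed

text \<open>While \<open>e\<close> is still present, all three sheets are available at every tetrahedron; removing
  \<open>e\<close> keeps only a sheet that is fixed by the monodromy around \<open>e\<close>.\<close>

definition invariant :: "'a set set \<Rightarrow> bool" where
  "invariant C \<longleftrightarrow> C \<subseteq> B \<and>
     (\<forall>T U. dual_adjacent B T U \<longrightarrow> T \<inter> U \<notin> C \<longrightarrow> T \<notin> C) \<and>
     (\<exists>c. section_off B lab C c) \<and>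
     (e \<in> C \<longrightarrow> (\<forall>T. \<forall>i<3. \<exists>c. section_off B lab C c \<and> c T = i))"

section \<open>Collapses preserve the invariant\<close>

lemma invariant_initial: "invariant B"
proof -
  \<comment> \<open>No shared triangle is missing yet, so the condition is vacuous and constants
    realise every sheet.\<close>
  have "section_off B lab B (\<lambda>_. i)" if "i < 3" for i
    using that adj_inter_mem unfolding section_off_def by blast
  moreover have "(0::nat) < 3" by simp
  ultimately show ?thesis unfolding invariant_def using adj_inter_mem by blast
qed

text \<open>Handles the collapses that remove no triangle: sections only see triangles, and losing
  \<open>e\<close> only weakens the invariant.\<close>

lemma invariant_no_triangle:
  assumes "invariant C" "C' \<subseteq> C" "\<And>t. card t = 3 \<Longrightarrow> t \<in> C \<Longrightarrow> t \<in> C'"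
  shows "invariant C'"
proof -
  have "section_off B lab C' c" if "section_off B lab C c" for c
    by (rule section_off_triangles_cong[OF that assms(3)])
  moreover have "T \<inter> U \<notin> C" if "dual_adjacent B T U" "T \<inter> U \<notin> C'" for T U
    using assms(3) that by (auto simp: dual_adjacent_def)
  ultimately show ?thesis using assms(1,2) unfolding invariant_def by (meson subsetD subset_trans)
qed

text \<open>As \<open>f\<close> is free, all triangles around it except \<open>t\<close> are gone,
  so a section follows the walk round \<open>f\<close> from one side of \<open>t\<close> to the
  other. It fits across \<open>t\<close> by trivial monodromy or, for \<open>f = e\<close>, by
  starting on a fixed sheet.\<close>

lemma invariant_triangle_edge:
  assumes inv: "invariant C" and f: "f \<in> C" "card f = 2" "f \<notin> boundary_complex B"
    and t: "t \<in> C" "card t = 3" "f \<subset> t" and free: "\<And>\<tau>. \<tau> \<in> C \<Longrightarrow> f \<subset> \<tau> \<Longrightarrow> \<tau> = t"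
  shows "invariant (C - {f, t})"
proof -
  let ?C = "C - {f, t}"
  have fB: "f \<in> B" using f inv by (auto simp: invariant_def)
  have tri: "X \<inter> Y \<notin> C \<or> X \<inter> Y = t" if "dual_adjacent B X Y" "X \<inter> Y \<notin> ?C" for X Y
    using that f by (auto simp: dual_adjacent_def)
  \<comment> \<open>A tetrahedron through \<open>t\<close> would be a second coface of the free face
    \<open>f\<close>.\<close>
  have removed: "X \<notin> ?C" if XY: "dual_adjacent B X Y" "X \<inter> Y \<notin> ?C" for X Y
  proof (cases "X \<inter> Y = t")
    case True
    then have "f \<subset> X" using t by blast
    then show ?thesis using free[of X] by blast
  next
    case False
    then show ?thesis using tri[OF XY] inv XY(1) unfolding invariant_def by blast
  qed
  \<comment> \<open>The only new condition is across \<open>t\<close>. One ordered pair suffices: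
    the pair is unique up to order and the labels are involutions.\<close>
  have ext: "section_off B lab ?C c"
    if c: "section_off B lab C c"
      and TU: "\<And>T U. dual_adjacent B T U \<Longrightarrow> T \<inter> U = t \<Longrightarrow>
        \<exists>P Q. dual_adjacent B P Q \<and> P \<inter> Q = t \<and> c Q = lab t (c P)" for c
  proof -
    have "c Y = lab (X \<inter> Y) (c X)" if XY: "dual_adjacent B X Y" "X \<inter> Y \<notin> ?C" for X Y
    proof (cases "X \<inter> Y = t")
      case False
      then show ?thesis using tri[OF XY] XY(1) c unfolding section_off_def by blast
    next
      case True
      from TU[OF XY(1) True] obtain P Q where
        PQ: "dual_adjacent B P Q" "P \<inter> Q = t" "c Q = lab t (c P)" by blast
      have "X = P \<and> Y = Q \<or> X = Q \<and> Y = P"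
        using adj_inter_unique[OF PQ(1) XY(1)] PQ(2) True by auto
      moreover have "c P < 3" using c by (simp add: section_off_def)
      ultimately show ?thesis using PQ lab True by auto
    qed
    then show ?thesis using c unfolding section_off_def by blast
  qed
  have walk: "c (last p) = holonomy lab p (c (hd p))"
    if "section_off B lab C c" "p \<noteq> []"
      "successively (\<lambda>P Q. dual_adjacent B P Q \<and> f \<subset> P \<inter> Q \<and> P \<inter> Q \<noteq> t) p" for c p
    using that(1,2)
  proof (rule section_off_holonomy)
    show "successively (\<lambda>P Q. dual_adjacent B P Q \<and> P \<inter> Q \<notin> C) p"
      by (rule successively_mono[OF that(3)]) (use free in blast)
  qed
  have closing: "\<exists>P Q. dual_adjacent B P Q \<and> P \<inter> Q = t \<and> c Q = lab t (c P)"
    if "section_off B lab C c" "dual_adjacent B T U" "T \<inter> U = t" "p \<noteq> []"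
      "hd p = T \<and> last p = U \<or> hd p = U \<and> last p = T"
      "successively (\<lambda>P Q. dual_adjacent B P Q \<and> f \<subset> P \<inter> Q \<and> P \<inter> Q \<noteq> t) p"
      "holonomy lab p (c (hd p)) = lab t (c (hd p))" for c T U p
  proof (intro exI conjI)
    show "dual_adjacent B (hd p) (last p)" "hd p \<inter> last p = t"
      using that(2,3,5) adj_sym by auto
    show "c (last p) = lab t (c (hd p))" using walk[OF that(1,4,6)] that(7) by simp
  qed
  note path = interior_edge[OF fB f(2,3)]
  have sub: "?C \<subseteq> B" using inv by (auto simp: invariant_def)
  show ?thesis
  proof (cases "f = e")
    case False
    have all: "section_off B lab ?C c" if c: "section_off B lab C c" for c
    proof (rule ext[OF c])
      fix T U assume TU: "dual_adjacent B T U" "T \<inter> U = t"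
      obtain p where p: "p \<noteq> []" "hd p = T \<and> last p = U \<or> hd p = U \<and> last p = T"
        "successively (\<lambda>P Q. dual_adjacent B P Q \<and> f \<subset> P \<inter> Q \<and> P \<inter> Q \<noteq> t) p"
        "\<forall>i<3. holonomy lab p i = lab t i"
        using path[OF TU(1), unfolded TU(2), OF t(3)] False by blast
      have "c (hd p) < 3" using c by (simp add: section_off_def)
      then show "\<exists>P Q. dual_adjacent B P Q \<and> P \<inter> Q = t \<and> c Q = lab t (c P)"
        using closing[OF c TU p(1-3)] p(4) by blast
    qed
    have "\<exists>c. section_off B lab ?C c" using inv all unfolding invariant_def by blast
    moreover have "\<forall>T. \<forall>i<3. \<exists>c. section_off B lab ?C c \<and> c T = i" if "e \<in> ?C"
      using inv all that unfolding invariant_def by (meson DiffD1)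
    ultimately show ?thesis using sub removed unfolding invariant_def by blast
  next
    case True
    have "\<exists>c. section_off B lab ?C c"
    proof (cases "\<exists>T U. dual_adjacent B T U \<and> T \<inter> U = t")
      case True
      then obtain T U where TU: "dual_adjacent B T U" "T \<inter> U = t" by blast
      obtain p i where p: "p \<noteq> []" "hd p = T \<and> last p = U \<or> hd p = U \<and> last p = T"
        "successively (\<lambda>P Q. dual_adjacent B P Q \<and> f \<subset> P \<inter> Q \<and> P \<inter> Q \<noteq> t) p"
        and i: "i < 3" "holonomy lab p i = lab t i"
        using path[OF TU(1), unfolded TU(2), OF t(3)] by blast
      \<comment> \<open>As \<open>e\<close> is still in \<open>C\<close>, the section can be made to
        start the walk on the sheet \<open>i\<close> fixed by the monodromy.\<close>
      obtain c where c: "section_off B lab C c" "c (hd p) = i"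
        using inv i(1) f(1) \<open>f = e\<close> unfolding invariant_def by blast
      have "section_off B lab ?C c"
        by (rule ext[OF c(1)]) (use closing[OF c(1) TU p] c(2) i(2) in blast)
      then show ?thesis by blast
    next
      case False
      obtain c where c: "section_off B lab C c" using inv unfolding invariant_def by blast
      have "section_off B lab ?C c" by (rule ext[OF c]) (use False in blast)
      then show ?thesis by blast
    qed
    then show ?thesis using sub removed True unfolding invariant_def by blast
  qed
qed

text \<open>While \<open>T\<close> is in \<open>C\<close>, so are all triangles it shares with
  neighbours, and its sheet is arbitrary. Opening \<open>s\<close> imposes one condition, solved by
  transporting the sheet of the neighbour across \<open>s\<close>.\<close>

lemma invariant_tetrahedron:
  assumes inv: "invariant C" and s: "s \<in> C" "card s = 3"
    and T: "T \<in> C" "card T = 4" "s \<subset> T" and free: "\<And>\<tau>. \<tau> \<in> C \<Longrightarrow> s \<subset> \<tau> \<Longrightarrow> \<tau> = T"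
  shows "invariant (C - {s, T})"
proof -
  let ?C = "C - {s, T}"
  have TB: "T \<in> B" using T inv by (auto simp: invariant_def)
  have tri: "X \<inter> Y \<notin> C \<or> X \<inter> Y = s" if "dual_adjacent B X Y" "X \<inter> Y \<notin> ?C" for X Y
    using that T by (auto simp: dual_adjacent_def)
  have removed: "X \<notin> ?C" if XY: "dual_adjacent B X Y" "X \<inter> Y \<notin> ?C" for X Y
  proof (cases "X \<inter> Y = s")
    case True
    moreover have "s \<noteq> X" using XY(1) s(2) by (auto simp: dual_adjacent_def)
    ultimately have "s \<subset> X" by blast
    then show ?thesis using free[of X] by blast
  next
    case False
    then show ?thesis using tri[OF XY] inv XY(1) unfolding invariant_def by blast
  qed
  have at_T: "X \<inter> Y = s" if "dual_adjacent B X Y" "X \<inter> Y \<notin> ?C" "X = T \<or> Y = T" for X Y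
    using tri[OF that(1,2)] that(1,3) T(1) inv adj_sym unfolding invariant_def
    by (metis Int_commute)
  have not_T: "X \<inter> Y \<noteq> s" if XY: "dual_adjacent B X Y" "X \<noteq> T" "Y \<noteq> T" for X Y
  proof
    assume eq: "X \<inter> Y = s"
    have TX: "T \<inter> X = s"
    proof -
      have "card (T \<inter> X) \<le> 3"
        using XY T TB by (intro card_inter_le_3) (auto simp: dual_adjacent_def)
      then show ?thesis
        using eq T s TB finite_face by (intro card_seteq[symmetric]) auto
    qed
    then have "dual_adjacent B T X" using XY T TB s by (auto simp: dual_adjacent_def)
    from adj_inter_unique[OF this XY(1)] TX eq show False using XY by blast
  qed
  have ext: "section_off B lab ?C (c(T := v))"
    if c: "section_off B lab C c" and v: "v < 3"
      and U: "\<And>U. dual_adjacent B T U \<Longrightarrow> T \<inter> U = s \<Longrightarrow> c U = lab s v" for c v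
  proof -
    have "(c(T := v)) Y = lab (X \<inter> Y) ((c(T := v)) X)"
      if XY: "dual_adjacent B X Y" "X \<inter> Y \<notin> ?C" for X Y
    proof -
      have "X \<noteq> Y" using XY by (simp add: dual_adjacent_def)
      consider "X \<noteq> T" "Y \<noteq> T" | "X = T" "Y \<noteq> T" | "Y = T" "X \<noteq> T" using \<open>X \<noteq> Y\<close> by blast
      then show ?thesis
      proof cases
        case 1
        then show ?thesis using tri[OF XY] not_T[OF XY(1)] c XY(1) unfolding section_off_def by auto
      next
        case 2
        then show ?thesis using at_T[OF XY] U XY(1) by auto
      next
        case 3
        then have "T \<inter> X = s" using at_T[OF XY] by (simp add: Int_commute)
        then have "c X = lab s v" using U[OF adj_sym] XY(1) 3 by auto
        then show ?thesis using 3 \<open>T \<inter> X = s\<close> lab(2)[OF v] by (simp add: Int_commute)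
      qed
    qed
    then show ?thesis using c v unfolding section_off_def by auto
  qed
  have ext': "\<exists>v. section_off B lab ?C (c(T := v))" if c: "section_off B lab C c" for c
  proof (cases "\<exists>U. dual_adjacent B T U \<and> T \<inter> U = s")
    case True
    then obtain U where U: "dual_adjacent B T U" "T \<inter> U = s" by blast
    have "c U < 3" using c by (simp add: section_off_def)
    then have "section_off B lab ?C (c(T := lab s (c U)))"
      using U pseudomanifold lab by (intro ext[OF c]) (metis+)
    then show ?thesis by blast
  next
    case False
    \<comment> \<open>Without a neighbour across \<open>s\<close> any sheet serves; 0 is a
      default.\<close>
    then have "section_off B lab ?C (c(T := 0))" by (intro ext[OF c]) auto
    then show ?thesis by blast
  qed
  have "\<exists>c. section_off B lab ?C c" using inv ext' unfolding invariant_def by blast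
  moreover have "\<exists>c. section_off B lab ?C c \<and> c S = i" if "e \<in> ?C" "i < 3" for S i
  proof -
    have all: "\<exists>c. section_off B lab C c \<and> c S = i" if "i < 3" for S i
      using inv that \<open>e \<in> ?C\<close> unfolding invariant_def by blast
    show ?thesis
    proof (cases "S = T")
      case False
      obtain c where c: "section_off B lab C c" "c S = i" using all \<open>i < 3\<close> by blast
      obtain v where "section_off B lab ?C (c(T := v))" using ext' c by blast
      then show ?thesis using c(2) False by (metis fun_upd_other)
    next
      case True
      \<comment> \<open>To reach sheet \<open>i\<close> at \<open>T\<close> itself, the sheet
        \<open>lab s i\<close> is prescribed at the neighbour across \<open>s\<close>.\<close>
      have "\<exists>c. section_off B lab C c \<and>
              (\<forall>U. dual_adjacent B T U \<and> T \<inter> U = s \<longrightarrow> c U = lab s i)"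
      proof (cases "\<exists>U. dual_adjacent B T U \<and> T \<inter> U = s")
        case True
        then obtain U where U: "dual_adjacent B T U" "T \<inter> U = s" by blast
        obtain c where "section_off B lab C c" "c U = lab s i" using all lab(1) \<open>i < 3\<close> by blast
        then show ?thesis using U pseudomanifold by metis
      next
        case False
        then show ?thesis using all \<open>i < 3\<close> by blast
      qed
      then obtain c where "section_off B lab C c"
        "\<And>U. dual_adjacent B T U \<Longrightarrow> T \<inter> U = s \<Longrightarrow> c U = lab s i" by blast
      from ext[OF this(1) \<open>i < 3\<close> this(2)] show ?thesis using True by (metis fun_upd_same)
    qed
  qed
  moreover have "?C \<subseteq> B" using inv by (auto simp: invariant_def)
  ultimately show ?thesis using removed unfolding invariant_def by blast
qed

text \<open>A triangle disappears as the larger face, as the smaller face or not at all. In the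
  first case \<open>bd\<close> makes the lost edge interior, so its monodromy is known.\<close>

lemma invariant_elementary_collapse:
  assumes inv: "invariant C" and C: "elementary_collapse C D"
    and bd: "\<And>f. card f = 2 \<Longrightarrow> f \<in> boundary_complex B \<Longrightarrow> f \<in> D"
  shows "invariant D"
proof -
  obtain \<sigma> T where \<sigma>: "\<sigma> \<in> C" "T \<in> C" "card T = card \<sigma> + 1" "\<sigma> \<subset> T"
    "\<And>\<tau>. \<tau> \<in> C \<Longrightarrow> \<sigma> \<subset> \<tau> \<Longrightarrow> \<tau> = T" and D: "D = C - {\<sigma>, T}"
    using C unfolding elementary_collapse_def by blast
  consider "card \<sigma> = 2" | "card \<sigma> = 3" | "card \<sigma> \<noteq> 3" "card T \<noteq> 3" using \<sigma>(3) by linarith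
  then show ?thesis
  proof cases
    case 1
    then have "\<sigma> \<notin> boundary_complex B" using bd D by blast
    then show ?thesis unfolding D using 1 \<sigma>(3)
      by (intro invariant_triangle_edge[OF inv \<sigma>(1) _ _ \<sigma>(2) _ \<sigma>(4,5)]) simp_all
  next
    case 2
    then show ?thesis unfolding D using 2 \<sigma>(3)
      by (intro invariant_tetrahedron[OF inv \<sigma>(1) _ \<sigma>(2) _ \<sigma>(4,5)]) simp_all
  next
    case 3
    then show ?thesis unfolding D by (intro invariant_no_triangle[OF inv]) auto
  qed
qed

text \<open>All boundary edges survive in the target, so every step preserves the invariant. At the
  end no shared triangle is left, so there is a section over the whole dual graph, which the loop
  without a fixed sheet forbids.\<close>

theorem not_collapses_onto_boundary_minus_facet:
  assumes \<sigma>: "\<sigma> \<in> facets (boundary_complex B)"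
  shows "\<not> collapses_onto B (boundary_complex B - {\<sigma>})"
proof
  let ?D = "boundary_complex B - {\<sigma>}"
  assume coll: "collapses_onto B ?D"
  have bd: "f \<in> ?D" if f: "card f = 2" "f \<in> boundary_complex B" for f
  proof -
    obtain t where t: "boundary_triangle B t" "f \<subseteq> t"
      using f(2) unfolding boundary_complex_iff by blast
    moreover have "card t = 3" using t(1) by (simp add: boundary_triangle_def)
    ultimately have "t \<in> boundary_complex B" "t \<noteq> f"
      using f(1) unfolding boundary_complex_iff by auto
    then have "f \<noteq> \<sigma>" using \<sigma> t(2) unfolding facets_def by blast
    then show ?thesis using f by simp
  qed
  have "elementary_collapse\<^sup>*\<^sup>* C ?D \<Longrightarrow> invariant C \<Longrightarrow> invariant ?D" for C
  proof (induction rule: converse_rtranclp_induct)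
    case (step C C')
    have "?D \<subseteq> C'" using step.hyps(2) collapses_onto_subset unfolding collapses_onto_def by blast
    then have "invariant C'"
      using bd by (intro invariant_elementary_collapse[OF step.prems step.hyps(1)]) blast
    then show ?case by (rule step.IH)
  qed
  then have "invariant ?D" using coll invariant_initial unfolding collapses_onto_def by blast
  then obtain c where c: "section_off B lab ?D c" by (auto simp: invariant_def)
  obtain p where p: "p \<noteq> []" "hd p = last p" "successively (dual_adjacent B) p"
    "\<forall>i<3. holonomy lab p i \<noteq> i" using loop by metis
  have "T \<inter> U \<notin> ?D" if TU: "dual_adjacent B T U" for T U
  proof
    assume "T \<inter> U \<in> ?D"
    then have "T \<inter> U \<in> boundary_complex B" by simp
    then obtain t where t: "boundary_triangle B t" "T \<inter> U \<subseteq> t"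
      unfolding boundary_complex_iff by blast
    have t3: "card t = 3" "t \<in> B" using t(1) by (simp_all add: boundary_triangle_def)
    have "T \<inter> U = t" using t t3 TU finite_face by (intro card_seteq) (auto simp: dual_adjacent_def)
    then have "t \<subseteq> T" "t \<subseteq> U" by blast+
    moreover have "t \<noteq> T" "t \<noteq> U" using TU t3(1) by (auto simp: dual_adjacent_def)
    moreover have "\<exists>!T. T \<in> B \<and> card T = 4 \<and> t \<subset> T" using t(1) by (simp add: boundary_triangle_def)
    ultimately show False using TU unfolding dual_adjacent_def by (metis psubsetI)
  qed
  then have "successively (\<lambda>T U. dual_adjacent B T U \<and> T \<inter> U \<notin> ?D) p"
    by (intro successively_mono[OF p(3)]) blast
  then have "c (last p) = holonomy lab p (c (hd p))"
    by (rule section_off_holonomy[OF c p(1)])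
  moreover have "c (hd p) < 3" using c by (simp add: section_off_def)
  ultimately show False using p(2,4) by metis
qed

end

subsection \<open>Lists of facets\<close>

definition list_complex :: "'a list list \<Rightarrow> 'a set set" where
  "list_complex F = generated (set ` set F)"

fun flip :: "'a list list \<Rightarrow> 'a list \<times> 'a list \<times> 'a list list \<Rightarrow> 'a list list" where
  "flip F (s, t, X) = filter (\<lambda>f. \<not> set s \<subseteq> set f) F @ [x @ t @ removeAll u s. x \<leftarrow> X, u \<leftarrow> s]"

text \<open>The hypotheses of \<open>bistellar_move\<close> in decidable form. Comparing
  \<open>A\<close> with \<open>A'\<close> checks, up to the order of vertices, that the facets
  through \<open>s\<close> are those of \<open>X * s * \<partial>t\<close>.\<close>

fun flip_ok :: "'a list list \<Rightarrow> 'a list \<times> 'a list \<times> 'a list list \<Rightarrow> bool" where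
  "flip_ok F (s, t, X) \<longleftrightarrow>
     s \<noteq> [] \<and> t \<noteq> [] \<and> set s \<inter> set t = {} \<and> (\<forall>x\<in>set X. set x \<inter> (set s \<union> set t) = {}) \<and>
     (\<forall>f\<in>set F. \<not> set t \<subseteq> set f) \<and>
     (let A = filter (\<lambda>f. set s \<subseteq> set f) F; A' = [x @ s @ removeAll u t. x \<leftarrow> X, u \<leftarrow> t] in
       (\<forall>f\<in>set A. \<exists>g\<in>set A'. set f = set g) \<and> (\<forall>g\<in>set A'. \<exists>f\<in>set A. set f = set g))"

fun flips_to :: "'a list list \<Rightarrow> ('a list \<times> 'a list \<times> 'a list list) list \<Rightarrow> 'a list list \<Rightarrow> bool" where
  "flips_to F [] G \<longleftrightarrow> F = G"
| "flips_to F (m # ms) G \<longleftrightarrow> flip_ok F m \<and> flips_to (flip F m) ms G"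

text \<open>The lists generate the current complex but need not consist of facets: after removing \<open>s\<close> and
  \<open>insert v s\<close>, the other boundary faces of \<open>insert v s\<close> are added even if they lie in larger
  simplices.\<close>

fun collapse_steps :: "'a list list \<Rightarrow> ('a \<times> 'a list) list \<Rightarrow> 'a \<Rightarrow> bool" where
  "collapse_steps F [] w \<longleftrightarrow> F \<noteq> [] \<and> (\<forall>f\<in>set F. set f = {w})"
| "collapse_steps F ((v, s) # ps) w \<longleftrightarrow>
     v \<notin> set s \<and> s \<noteq> [] \<and>
     (let A = filter (\<lambda>f. set s \<subseteq> set f) F in
       (\<exists>f\<in>set A. v \<in> set f) \<and> (\<forall>f\<in>set A. set f \<subseteq> insert v (set s))) \<and>
     collapse_steps (filter (\<lambda>f. \<not> set s \<subseteq> set f) F @ map (\<lambda>u. v # removeAll u s) s) ps w"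

lemma flip_homeomorphic:
  assumes "flip_ok F m"
  shows "underlying_space (list_complex F) homeomorphic underlying_space (list_complex (flip F m))"
proof -
  obtain s t X where m: "m = (s, t, X)" by (cases m)
  define R where "R = set ` {f \<in> set F. \<not> set s \<subseteq> set f}"
  let ?X = "set ` set X"
  define A where "A = set ` {f \<in> set F. set s \<subseteq> set f}"
  have A: "A = (\<Union>x\<in>?X. (\<lambda>u. x \<union> set s \<union> (set t - {u})) ` set t)"
  proof -
    define A' where "A' = [x @ s @ removeAll u t. x \<leftarrow> X, u \<leftarrow> t]"
    have "\<forall>f\<in>set (filter (\<lambda>f. set s \<subseteq> set f) F). \<exists>g\<in>set A'. set f = set g"
      "\<forall>g\<in>set A'. \<exists>f\<in>set (filter (\<lambda>f. set s \<subseteq> set f) F). set f = set g"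
      using assms unfolding m flip_ok.simps Let_def A'_def[symmetric] by simp_all
    then have "A = set ` set A'"
      unfolding A_def set_filter by (intro set_eqI iffI; elim imageE) (metis imageI)+
    also have "\<dots> = (\<Union>x\<in>?X. (\<lambda>u. x \<union> set s \<union> (set t - {u})) ` set t)"
      unfolding A'_def by (simp add: image_UN image_image Un_assoc)
    finally show ?thesis .
  qed
  interpret bistellar_move R ?X "set s" "set t"
    using assms unfolding m R_def by unfold_locales auto
  have "set ` set F = R \<union> A" unfolding R_def A_def by blast
  also have "\<dots> = stellar_pair R ?X (set s) (set t)" unfolding stellar_pair_def A ..
  finally have 1: "list_complex F = generated (stellar_pair R ?X (set s) (set t))"
    by (simp add: list_complex_def)
  have "set ` set (flip F m) = stellar_pair R ?X (set t) (set s)"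
    unfolding m stellar_pair_def R_def by (simp add: image_UN image_image image_Un Un_assoc)
  then have 2: "list_complex (flip F m) = generated (stellar_pair R ?X (set t) (set s))"
    by (simp add: list_complex_def)
  show ?thesis unfolding 1 2 by (rule homeomorphic_stellar_pair)
qed

lemma flips_homeomorphic:
  "flips_to F ms G \<Longrightarrow> underlying_space (list_complex F) homeomorphic underlying_space (list_complex G)"
proof (induction ms arbitrary: F)
  case (Cons m ms)
  then show ?case using flip_homeomorphic homeomorphic_trans by (meson flips_to.simps(2))
qed (simp add: homeomorphic_refl)

text \<open>All generators above \<open>s\<close> lie within \<open>insert v s\<close>, so
  \<open>s\<close> is free. A surviving face of \<open>insert v s\<close> misses some
  \<open>u\<close> in \<open>s\<close> and hence lies under an added generator.\<close>

lemma collapse_steps_collapses_onto: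
  "collapse_steps F ps w \<Longrightarrow> collapses_onto (list_complex F) {{w}}"
proof (induction F ps w rule: collapse_steps.induct)
  case (1 F w)
  then have "set ` set F = {{w}}" by (cases F) auto
  then have "list_complex F = {{w}}" by (auto simp: list_complex_def generated_def)
  then show ?case by (simp add: collapses_onto_def)
next
  case (2 F v s ps w)
  let ?T = "insert v (set s)"
  let ?F' = "filter (\<lambda>f. \<not> set s \<subseteq> set f) F @ map (\<lambda>u. v # removeAll u s) s"
  have v: "v \<notin> set s" and s: "set s \<noteq> {}"
    and free: "\<And>f. f \<in> set F \<Longrightarrow> set s \<subseteq> set f \<Longrightarrow> set f \<subseteq> ?T"
    using "2.prems" by (simp_all add: Let_def)
  have "\<exists>f\<in>set F. set s \<subseteq> set f \<and> v \<in> set f" using "2.prems" by (auto simp: Let_def)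
  then obtain f where f: "f \<in> set F" "?T \<subseteq> set f" by auto
  have mem: "set s \<in> list_complex F" "?T \<in> list_complex F"
    using f s by (auto simp: list_complex_def generated_def)
  have only: "\<tau> = set s \<or> \<tau> = ?T" if \<tau>: "\<tau> \<in> list_complex F" "set s \<subseteq> \<tau>" for \<tau>
  proof -
    obtain g where "g \<in> set F" "\<tau> \<subseteq> set g" using \<tau>(1) by (auto simp: list_complex_def generated_def)
    then have "\<tau> \<subseteq> ?T" using free[of g] \<tau>(2) by blast
    then show ?thesis using \<tau>(2) by blast
  qed
  have "list_complex ?F' = list_complex F - {set s, ?T}"
  proof (intro set_eqI iffI)
    fix \<tau> assume "\<tau> \<in> list_complex ?F'"
    then obtain g where g: "\<tau> \<noteq> {}" "\<tau> \<subseteq> set g" "g \<in> set ?F'"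
      by (auto simp: list_complex_def generated_def)
    have "\<not> set s \<subseteq> set g" using g(3) v by auto
    moreover have "\<exists>h\<in>set F. \<tau> \<subseteq> set h"
    proof (cases "g \<in> set F")
      case False
      then have "set g \<subseteq> ?T" using g(3) by auto
      then show ?thesis using g(2) f by blast
    qed (use g in blast)
    ultimately show "\<tau> \<in> list_complex F - {set s, ?T}"
      using g(1,2) by (auto simp: list_complex_def generated_def)
  next
    fix \<tau> assume \<tau>: "\<tau> \<in> list_complex F - {set s, ?T}"
    then obtain g where g: "\<tau> \<noteq> {}" "\<tau> \<subseteq> set g" "g \<in> set F"
      by (auto simp: list_complex_def generated_def)
    have "\<exists>h\<in>set ?F'. \<tau> \<subseteq> set h"
    proof (cases "set s \<subseteq> set g")
      case True
      then have "\<tau> \<subseteq> ?T" using free g by blast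
      moreover obtain u where "u \<in> set s" "u \<notin> \<tau>" using only \<tau> by blast
      ultimately show ?thesis by (intro bexI[of _ "v # removeAll u s"]) auto
    qed (use g in auto)
    then show "\<tau> \<in> list_complex ?F'" using g(1) by (auto simp: list_complex_def generated_def)
  qed
  moreover have "elementary_collapse (list_complex F) (list_complex F - {set s, ?T})"
    unfolding elementary_collapse_def
    by (intro bexI[OF _ mem(1)] bexI[OF _ mem(2)]) (use v only in auto)
  moreover have "collapses_onto (list_complex ?F') {{w}}"
    using 2 by simp
  ultimately show ?case
    unfolding collapses_onto_def by (simp add: converse_rtranclp_into_rtranclp)
qed

subsection \<open>The knotted ball\<close>

text \<open>A trefoil occupies three edges of a triangulated 3-sphere with 13 vertices and 56
  tetrahedra; deleting the open star of one of its vertices leaves these 36 tetrahedra, with the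
  opposite knot edge \<open>{4, 5}\<close> as a knotted spanning edge.\<close>

definition tetrahedra :: "nat list list" where
  "tetrahedra =
   [[0,1,2,7], [0,1,5,7], [0,1,5,10], [0,2,6,9], [0,2,7,9], [0,3,4,5], [0,3,4,6], [0,3,5,10],
    [0,4,5,9], [0,4,6,9], [0,5,7,9], [1,2,3,4], [1,2,4,7], [1,3,4,9], [1,4,6,9], [1,4,6,11],
    [1,4,7,11], [1,5,6,10], [1,5,6,11], [1,5,7,11], [1,6,9,10], [2,3,4,11], [2,4,7,8],
    [2,4,8,10], [2,4,10,11], [2,5,6,10], [2,5,10,11], [2,6,9,10], [2,7,8,9], [2,8,9,10],
    [3,4,5,9], [3,4,6,11], [3,5,7,9], [3,5,7,10], [4,7,10,11], [5,7,10,11]]"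

text \<open>Found by computer search. An entry \<open>(s, t, X)\<close> replaces \<open>X * s * \<partial>t\<close> by \<open>X * \<partial>s * t\<close>.\<close>

definition simplification :: "(nat list \<times> nat list \<times> nat list list) list" where
  "simplification =
   [([4,5], [0,3,9], [[]]), ([5,9], [0,3,7], [[]]), ([3,5], [0,7,10], [[]]),
    ([0,5], [1,7,10], [[]]), ([5,7], [1,10,11], [[]]), ([7,11], [1,4,10], [[]]),
    ([6,10], [5,9], [[2], [1]]), ([0,4], [3,6,9], [[]]), ([4,9], [1,3,6], [[]]),
    ([8], [4,9], [[2,10], [2,7]]), ([4,6], [1,3,11], [[]]), ([3,4], [1,2,11], [[]]),
    ([4,11], [1,2,10], [[]]), ([1,4], [2,7,10], [[]]), ([4], [7,9,10], [[2]]),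
    ([1,7], [0,2,10], [[]]), ([10,11], [1,2,5], [[]]), ([11], [3,5], [[1,6], [1,2]]),
    ([2,7], [0,9,10], [[]]), ([7], [3,9,10], [[0]]), ([1,6], [3,5,9], [[]]),
    ([6], [0,5], [[3,9], [2,9]]), ([5,10], [1,2,9], [[]]), ([1,5], [2,3,9], [[]]),
    ([5], [0,2,3], [[9]]), ([0,9], [2,3,10], [[]]), ([9], [1,3,10], [[2]]),
    ([10], [0,1,3], [[2]])]"

text \<open>An entry \<open>(v, s)\<close> collapses \<open>insert v s\<close> through its free face \<open>s\<close>.\<close>

definition collapse_pairs :: "(nat \<times> nat list) list" where
  "collapse_pairs =
   [(5, [0,1,10]), (6, [1,9,10]), (5, [3,7,10]), (4, [1,6,9]), (5, [3,7,9]), (11, [5,7,10]),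
    (2, [8,9,10]), (4, [3,5,9]), (10, [2,5,6]), (4, [2,8,10]), (2, [4,7,8]), (5, [0,3,10]),
    (4, [1,3,9]), (7, [0,1,2]), (7, [2,8,9]), (9, [2,6,10]), (6, [1,5,10]), (0, [4,5,9]),
    (0, [3,4,5]), (7, [0,5,9]), (11, [1,4,6]), (5, [0,1,7]), (9, [0,2,7]), (11, [1,5,7]),
    (2, [1,3,4]), (6, [0,3,4]), (11, [2,3,4]), (6, [0,2,9]), (10, [2,4,11]), (0, [4,6,9]),
    (11, [2,5,10]), (4, [3,6,11]), (7, [1,2,4]), (11, [1,5,6]), (4, [1,7,11]), (10, [4,7,11]),
    (5, [0,10]), (6, [1,10]), (6, [0,2]), (7, [5,9]), (4, [8,10]), (2, [4,8]), (11, [2,5]),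
    (4, [3,9]), (5, [3,7]), (11, [1,6]), (9, [2,6]), (4, [1,9]), (2, [1,3]), (5, [0,1]),
    (0, [4,9]), (0, [4,5]), (7, [2,8]), (11, [1,5]), (7, [1,2]), (9, [7,8]), (4, [1,11]),
    (7, [1,4]), (11, [2,3]), (6, [0,4]), (4, [3,11]), (5, [3,10]), (0, [3,5]), (10, [2,11]),
    (7, [0,5]), (11, [5,7]), (6, [3,4]), (10, [7,11]), (11, [4,6]), (0, [3,6]), (4, [7,10]),
    (5, [6,11]), (10, [5,11]), (10, [4,11]), (9, [0,6]), (10, [5,6]), (7, [0,9]), (2, [4,7]),
    (2, [4,10]), (9, [2,7]), (9, [6,10]), (9, [2,10]), (0, [3]), (9, [8]), (9, [6]), (7, [1]),
    (2, [4]), (9, [2]), (10, [5]), (7, [0]), (10, [11]), (9, [10]), (7, [9])]"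

text \<open>The trefoil group acts on three sheets through its surjection onto \<open>S\<^sub>3\<close>. The covering is
  trivialised over the tetrahedra so that crossing a triangle acts by a transposition or, for the
  triangles not listed, by the identity; so crossing directions do not matter.\<close>

definition labels :: "(nat list \<times> nat list) list" where
  "labels =
   [([1,5,10], [1,0,2]), ([6,9,10], [0,2,1]), ([5,7,10], [1,0,2]), ([1,5,7], [1,0,2]),
    ([3,4,5], [2,1,0]), ([4,6,9], [0,2,1]), ([5,6,10], [0,2,1]), ([1,3,4], [1,0,2]),
    ([3,4,9], [0,2,1]), ([3,4,6], [0,2,1]), ([3,5,10], [2,1,0]), ([1,4,7], [1,0,2])]"

text \<open>The tetrahedra around each interior edge in cyclic order. A rotation cuts the cycle open
  at a chosen triangle, which gives the walks that \<open>interior_edge\<close> asks for.\<close>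

definition edge_cycles :: "(nat list \<times> nat list list) list" where
  "edge_cycles =
   [([0,4], [[0,3,4,5], [0,3,4,6], [0,4,6,9], [0,4,5,9]]),
    ([0,5], [[0,1,5,10], [0,1,5,7], [0,5,7,9], [0,4,5,9], [0,3,4,5], [0,3,5,10]]),
    ([0,7], [[0,2,7,9], [0,5,7,9], [0,1,5,7], [0,1,2,7]]),
    ([0,9], [[0,2,6,9], [0,2,7,9], [0,5,7,9], [0,4,5,9], [0,4,6,9]]),
    ([1,4], [[1,4,6,11], [1,4,6,9], [1,3,4,9], [1,2,3,4], [1,2,4,7], [1,4,7,11]]),
    ([1,5], [[0,1,5,10], [0,1,5,7], [1,5,7,11], [1,5,6,11], [1,5,6,10]]),
    ([1,6], [[1,6,9,10], [1,4,6,9], [1,4,6,11], [1,5,6,11], [1,5,6,10]]),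
    ([1,7], [[0,1,5,7], [1,5,7,11], [1,4,7,11], [1,2,4,7], [0,1,2,7]]),
    ([1,11], [[1,4,6,11], [1,5,6,11], [1,5,7,11], [1,4,7,11]]),
    ([2,4], [[2,3,4,11], [1,2,3,4], [1,2,4,7], [2,4,7,8], [2,4,8,10], [2,4,10,11]]),
    ([2,7], [[0,2,7,9], [2,7,8,9], [2,4,7,8], [1,2,4,7], [0,1,2,7]]),
    ([2,8], [[2,8,9,10], [2,4,8,10], [2,4,7,8], [2,7,8,9]]),
    ([2,9], [[2,8,9,10], [2,6,9,10], [0,2,6,9], [0,2,7,9], [2,7,8,9]]),
    ([2,10], [[2,8,9,10], [2,6,9,10], [2,5,6,10], [2,5,10,11], [2,4,10,11], [2,4,8,10]]),
    ([3,4], [[2,3,4,11], [1,2,3,4], [1,3,4,9], [3,4,5,9], [0,3,4,5], [0,3,4,6], [3,4,6,11]]),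
    ([3,5], [[0,3,4,5], [3,4,5,9], [3,5,7,9], [3,5,7,10], [0,3,5,10]]),
    ([4,5], [[0,3,4,5], [3,4,5,9], [0,4,5,9]]),
    ([4,6], [[1,4,6,11], [1,4,6,9], [0,4,6,9], [0,3,4,6], [3,4,6,11]]),
    ([4,9], [[1,4,6,9], [1,3,4,9], [3,4,5,9], [0,4,5,9], [0,4,6,9]]),
    ([4,11], [[1,4,6,11], [3,4,6,11], [2,3,4,11], [2,4,10,11], [4,7,10,11], [1,4,7,11]]),
    ([5,7], [[5,7,10,11], [1,5,7,11], [0,1,5,7], [0,5,7,9], [3,5,7,9], [3,5,7,10]]),
    ([5,9], [[3,4,5,9], [0,4,5,9], [0,5,7,9], [3,5,7,9]]),
    ([5,10], [[0,1,5,10], [1,5,6,10], [2,5,6,10], [2,5,10,11], [5,7,10,11], [3,5,7,10], [0,3,5,10]]),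
    ([6,9], [[0,2,6,9], [2,6,9,10], [1,6,9,10], [1,4,6,9], [0,4,6,9]]),
    ([6,10], [[1,6,9,10], [1,5,6,10], [2,5,6,10], [2,6,9,10]]),
    ([7,11], [[5,7,10,11], [1,5,7,11], [1,4,7,11], [4,7,10,11]]),
    ([10,11], [[5,7,10,11], [4,7,10,11], [2,4,10,11], [2,5,10,11]])]"

text \<open>These certify that the edges of the ball missing from \<open>edge_cycles\<close> lie on
  the boundary.\<close>

definition boundary_triangles :: "nat list list" where
  "boundary_triangles =
   [[0,1,2], [0,1,10], [0,2,6], [0,3,6], [0,3,10], [1,2,3], [1,3,9], [1,9,10], [2,3,11],
    [2,5,6], [2,5,11], [3,6,11], [3,7,9], [3,7,10], [4,7,8], [4,7,10], [4,8,10], [5,6,11],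
    [7,8,9], [8,9,10]]"

text \<open>A closed dual walk whose holonomy is a 3-cycle.\<close>

definition monodromy_walk :: "nat list list" where
  "monodromy_walk =
   [[0,1,2,7], [0,1,5,7], [0,1,5,10], [1,5,6,10], [1,6,9,10], [2,6,9,10], [0,2,6,9], [0,2,7,9],
    [0,1,2,7]]"

definition knotted_edge :: "nat list" where
  "knotted_edge = [4, 5]"

definition sheet_perm :: "nat set \<Rightarrow> nat \<Rightarrow> nat" where
  "sheet_perm t i = (case find (\<lambda>(s, p). set s = t) labels of None \<Rightarrow> i | Some (s, p) \<Rightarrow> p ! i)"

text \<open>The walk goes round \<open>f\<close> between the two sides of \<open>t\<close> without
  crossing \<open>t\<close>. Agreement of \<open>h\<close> and \<open>l\<close> on a sheet says that
  the full turn round \<open>f\<close> fixes that sheet.\<close>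

definition path_ok :: "nat list \<Rightarrow> nat list list \<Rightarrow> bool" where
  "path_ok f p \<longleftrightarrow> p \<noteq> [] \<and>
     (let t = set (hd p) \<inter> set (last p); h = holonomy sheet_perm (map set p); l = sheet_perm t in
       successively (\<lambda>P Q. card (set P \<inter> set Q) = 3 \<and> set f \<subseteq> set P \<inter> set Q \<and> set P \<inter> set Q \<noteq> t) p \<and>
       (if f = knotted_edge then \<exists>i\<in>set [0,1,2]. h i = l i else \<forall>i\<in>set [0,1,2]. h i = l i))"

text \<open>Conditionals are evaluated lazily by the simplifier, unlike disjunctions and implications;
  hence the branches \<open>else True\<close>.\<close>

definition edge_ok :: "nat list \<times> nat list list \<Rightarrow> bool" where
  "edge_ok = (\<lambda>(f, cyc). set cyc \<subseteq> set tetrahedra \<and>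
     (\<forall>T\<in>set (filter (\<lambda>T. set f \<subseteq> set T) tetrahedra). T \<in> set cyc) \<and>
     (let ps = map (\<lambda>n. rotate n cyc) [0..<length cyc] in
       (\<forall>p\<in>set ps. path_ok f p) \<and>
       (\<forall>T\<in>set cyc. \<forall>U\<in>set cyc. if card (set T \<inter> set U) = 3
          then \<exists>p\<in>set ps. hd p = T \<and> last p = U \<or> hd p = U \<and> last p = T else True)))"

section \<open>Certificates checked by evaluation\<close>

lemma tetrahedra_card: "\<forall>T\<in>set tetrahedra. card (set T) = 4"
  unfolding tetrahedra_def by code_simp

text \<open>\<open>flips_to\<close> compares lists literally, and the last move emits the vertices
  in this order.\<close>

lemma flips: "flips_to tetrahedra simplification [[2,0,1,3]]"
  unfolding tetrahedra_def simplification_def by code_simp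

lemma labels_involutive: "\<forall>(t, p)\<in>set labels. \<forall>i\<in>set [0,1,2]. p ! i < 3 \<and> p ! (p ! i) = i"
  unfolding labels_def by code_simp

lemma tetrahedra_pseudomanifold:
  "\<forall>T\<in>set tetrahedra. \<forall>v\<in>set T. length (filter (\<lambda>U. set (removeAll v T) \<subseteq> set U) tetrahedra) \<le> 2"
  unfolding tetrahedra_def by code_simp

lemma edges_ok: "\<forall>c\<in>set edge_cycles. edge_ok c"
  by code_simp

lemma edges_covered:
  "\<forall>T\<in>set tetrahedra. \<forall>u\<in>set T. \<forall>v\<in>set T. if u < v
     then if \<exists>b\<in>set boundary_triangles. u \<in> set b \<and> v \<in> set b then True
       else \<exists>(f, c)\<in>set edge_cycles. f = [u, v]
     else True"
  by code_simp

lemma boundary_triangles: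
  "\<forall>b\<in>set boundary_triangles. card (set b) = 3 \<and>
     length (filter (\<lambda>T. set b \<subseteq> set T) tetrahedra) = 1"
  by code_simp

lemma monodromy_walk:
  "set monodromy_walk \<subseteq> set tetrahedra \<and> monodromy_walk \<noteq> [] \<and> hd monodromy_walk = last monodromy_walk \<and>
   successively (\<lambda>P Q. card (set P \<inter> set Q) = 3) monodromy_walk \<and>
   (\<forall>i\<in>set [0,1,2]. holonomy sheet_perm (map set monodromy_walk) i \<noteq> i)"
  by code_simp

lemma collapse_ok: "collapse_steps tetrahedra collapse_pairs 7"
  by code_simp

section \<open>From the list checks to the complex\<close>

abbreviation knotted_ball :: "nat set set" where
  "knotted_ball \<equiv> list_complex tetrahedra"

lemma less_3_iff: "i < 3 \<longleftrightarrow> i \<in> set [0, 1, 2]" for i :: nat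
  by auto

lemma tetrahedron_of_card:
  assumes "T \<in> knotted_ball" "card T = 4"
  obtains l where "l \<in> set tetrahedra" "T = set l"
proof -
  obtain l where l: "l \<in> set tetrahedra" "T \<subseteq> set l"
    using assms(1) by (auto simp: list_complex_def generated_def)
  then have "T = set l" using tetrahedra_card assms(2) by (intro card_seteq) auto
  then show ?thesis using l that by blast
qed

lemma set_tetrahedron_mem:
  assumes "l \<in> set tetrahedra"
  shows "set l \<in> knotted_ball" "card (set l) = 4"
proof -
  show l4: "card (set l) = 4" using tetrahedra_card assms by blast
  then have "set l \<noteq> {}" by auto
  then show "set l \<in> knotted_ball" using assms by (auto simp: list_complex_def generated_def)
qed

lemma dual_adjacent_lists:
  assumes "dual_adjacent knotted_ball T U"
  obtains k l where "k \<in> set tetrahedra" "T = set k" "l \<in> set tetrahedra" "U = set l"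
    "card (set k \<inter> set l) = 3"
proof -
  have T: "T \<in> knotted_ball" "card T = 4" and U: "U \<in> knotted_ball" "card U = 4" and "card (T \<inter> U) = 3"
    using assms by (auto simp: dual_adjacent_def)
  obtain k where k: "k \<in> set tetrahedra" "T = set k" using tetrahedron_of_card[OF T] .
  obtain l where l: "l \<in> set tetrahedra" "U = set l" using tetrahedron_of_card[OF U] .
  show thesis using that[OF k l] \<open>card (T \<inter> U) = 3\<close> k l by simp
qed

lemma dual_adjacent_set:
  assumes "k \<in> set tetrahedra" "l \<in> set tetrahedra" "card (set k \<inter> set l) = 3"
  shows "dual_adjacent knotted_ball (set k) (set l)"
proof -
  have "set k \<noteq> set l" using set_tetrahedron_mem(2)[OF assms(2)] assms(3) by auto
  then show ?thesis using assms set_tetrahedron_mem unfolding dual_adjacent_def by simp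
qed

lemma sheet_perm_cases: "sheet_perm t = (\<lambda>i. i) \<or> (\<exists>s p. (s, p) \<in> set labels \<and> sheet_perm t = (!) p)"
proof (cases "find (\<lambda>(s, p). set s = t) labels")
  case None
  then show ?thesis by (simp add: sheet_perm_def fun_eq_iff)
next
  case (Some sp)
  moreover obtain a p where sp: "sp = (a, p)" by (cases sp)
  ultimately have "(a, p) \<in> set labels" by (metis find_Some_iff nth_mem)
  moreover have "sheet_perm t = (!) p" using Some sp by (simp add: sheet_perm_def fun_eq_iff)
  ultimately show ?thesis by blast
qed

text \<open>Otherwise three distinct listed tetrahedra would contain the triangle left after
  deleting one vertex of \<open>T\<close>, against the bound of two.\<close>

lemma ball_pseudomanifold:
  assumes "dual_adjacent knotted_ball T U" "dual_adjacent knotted_ball T V" "T \<inter> U = T \<inter> V"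
  shows "U = V"
proof (rule ccontr)
  assume "U \<noteq> V"
  obtain k l where k: "k \<in> set tetrahedra" "T = set k" and l: "l \<in> set tetrahedra" "U = set l"
    using dual_adjacent_lists[OF assms(1)] by metis
  obtain m where m: "m \<in> set tetrahedra" "V = set m"
    using dual_adjacent_lists[OF assms(2)] by metis
  have "card (T - T \<inter> U) = 1"
    using assms(1) card_Diff_subset[of "T \<inter> U" T] k by (auto simp: dual_adjacent_def)
  then obtain v where v: "T - T \<inter> U = {v}" by (auto simp: card_1_singleton_iff)
  let ?L = "filter (\<lambda>W. set (removeAll v k) \<subseteq> set W) tetrahedra"
  have "set (removeAll v k) = T \<inter> U" using v k(2) by auto
  then have "{k, l, m} \<subseteq> set ?L" using k l m assms(3) by auto
  then have "card {k, l, m} \<le> card (set ?L)" by (intro card_mono) auto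
  also have "\<dots> \<le> length ?L" by (rule card_length)
  also have "\<dots> \<le> 2" using tetrahedra_pseudomanifold k v by blast
  finally have "card {k, l, m} \<le> 2" .
  moreover have "k \<noteq> l" "k \<noteq> m" "l \<noteq> m"
    using assms(1,2) k l m \<open>U \<noteq> V\<close> by (auto simp: dual_adjacent_def)
  ultimately show False by simp
qed

lemma boundary_triangle_ball:
  assumes "b \<in> set boundary_triangles"
  shows "boundary_triangle knotted_ball (set b)"
proof -
  have b3: "card (set b) = 3" and "length (filter (\<lambda>T. set b \<subseteq> set T) tetrahedra) = 1"
    using boundary_triangles assms by auto
  then obtain l where l: "filter (\<lambda>T. set b \<subseteq> set T) tetrahedra = [l]"
    by (auto simp: length_Suc_conv)
  have "set (filter (\<lambda>T. set b \<subseteq> set T) tetrahedra) = {l}" unfolding l by simp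
  then have mem: "T \<in> set tetrahedra \<and> set b \<subseteq> set T \<longleftrightarrow> T = l" for T
    unfolding set_filter by blast
  have "set b \<noteq> {}" using b3 by auto
  then have "set b \<in> knotted_ball" using mem[of l] by (auto simp: list_complex_def generated_def)
  moreover have "\<exists>!T. T \<in> knotted_ball \<and> card T = 4 \<and> set b \<subset> T"
  proof (rule ex1I[of _ "set l"])
    show "set l \<in> knotted_ball \<and> card (set l) = 4 \<and> set b \<subset> set l"
      using mem[of l] set_tetrahedron_mem[of l] b3 by auto
    show "T = set l" if T: "T \<in> knotted_ball \<and> card T = 4 \<and> set b \<subset> T" for T
    proof -
      obtain k where "k \<in> set tetrahedra" "T = set k" using T tetrahedron_of_card by blast
      then show ?thesis using T mem[of k] by blast
    qed
  qed
  ultimately show ?thesis using b3 by (simp add: boundary_triangle_def)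
qed

lemma interior_edge_ball:
  assumes "f \<in> knotted_ball" "card f = 2" "f \<notin> boundary_complex knotted_ball"
  obtains u v cyc where "([u, v], cyc) \<in> set edge_cycles" "f = {u, v}" "u < v"
proof -
  obtain l where l: "l \<in> set tetrahedra" "f \<subseteq> set l"
    using assms(1) by (auto simp: list_complex_def generated_def)
  obtain u v where uv: "f = {u, v}" "u < v"
    using assms(2) by (metis card_2_iff insert_commute linorder_neqE_nat)
  have "\<not> (\<exists>b\<in>set boundary_triangles. u \<in> set b \<and> v \<in> set b)"
  proof
    assume "\<exists>b\<in>set boundary_triangles. u \<in> set b \<and> v \<in> set b"
    then obtain b where "b \<in> set boundary_triangles" "f \<subseteq> set b" "f \<noteq> {}" using uv by auto
    then show False using assms(3) boundary_triangle_ball boundary_complex_iff by metis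
  qed
  moreover have "u \<in> set l" "v \<in> set l" using uv l by auto
  ultimately have "\<exists>(g, c)\<in>set edge_cycles. g = [u, v]"
    using edges_covered l(1) uv(2) by metis
  then show ?thesis using that uv by force
qed

interpretation branched_cover knotted_ball sheet_perm "set knotted_edge"
proof
  show "finite_complex knotted_ball"
    unfolding list_complex_def by (rule finite_complex_generated) auto
next
  fix i :: nat and t assume "i < 3"
  then have "p ! i < 3 \<and> p ! (p ! i) = i" if "(s, p) \<in> set labels" for s p
    using labels_involutive that unfolding less_3_iff by blast
  then show "sheet_perm t i < 3" "sheet_perm t (sheet_perm t i) = i"
    using sheet_perm_cases[of t] \<open>i < 3\<close> by auto
next
  show "U = V" if "dual_adjacent knotted_ball T U" "dual_adjacent knotted_ball T V" "T \<inter> U = T \<inter> V" for T U V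
    using that by (rule ball_pseudomanifold)
next
  fix f T U
  assume f: "f \<in> knotted_ball" "card f = 2" "f \<notin> boundary_complex knotted_ball"
    and TU: "dual_adjacent knotted_ball T U" "f \<subset> T \<inter> U"
  obtain u v cyc where uv: "([u, v], cyc) \<in> set edge_cycles" "f = {u, v}" "u < v"
    using interior_edge_ball[OF f] .
  define g where "g = [u, v]"
  have g: "(g, cyc) \<in> set edge_cycles" "f = set g" using uv by (auto simp: g_def)
  obtain k l where kl: "k \<in> set tetrahedra" "T = set k" "l \<in> set tetrahedra" "U = set l"
    "card (set k \<inter> set l) = 3"
    using dual_adjacent_lists[OF TU(1)] .
  have ok: "edge_ok (g, cyc)" using edges_ok g(1) by blast
  then have cyc: "set cyc \<subseteq> set tetrahedra" by (simp add: edge_ok_def)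
  have "k \<in> set cyc" "l \<in> set cyc" using ok kl TU(2) g(2) by (auto simp: edge_ok_def)
  then have "if card (set k \<inter> set l) = 3
      then \<exists>p\<in>set (map (\<lambda>n. rotate n cyc) [0..<length cyc]).
        hd p = k \<and> last p = l \<or> hd p = l \<and> last p = k else True"
    using ok unfolding edge_ok_def Let_def prod.case by blast
  \<comment> \<open>This rotation starts on one side of \<open>T \<inter> U\<close> and ends on the
    other; \<open>path_ok\<close> shows that it avoids that triangle.\<close>
  then obtain n where n: "n < length cyc"
    "hd (rotate n cyc) = k \<and> last (rotate n cyc) = l \<or> hd (rotate n cyc) = l \<and> last (rotate n cyc) = k"
    using kl(5) by auto
  have path: "path_ok g (rotate n cyc)"
    using ok n(1) by (simp add: edge_ok_def)
  define p where "p = rotate n cyc"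
  have p: "set p \<subseteq> set tetrahedra" "path_ok g p" "p \<noteq> []" "hd p = k \<and> last p = l \<or> hd p = l \<and> last p = k"
    using n path cyc by (auto simp: p_def path_ok_def)
  have t: "set (hd p) \<inter> set (last p) = T \<inter> U" using p(4) kl by auto
  have succ: "successively (\<lambda>P Q. card (set P \<inter> set Q) = 3 \<and> set g \<subseteq> set P \<inter> set Q
      \<and> set P \<inter> set Q \<noteq> T \<inter> U) p"
    and hol: "if g = knotted_edge then \<exists>i\<in>set [0,1,2]. holonomy sheet_perm (map set p) i = sheet_perm (T \<inter> U) i
      else \<forall>i\<in>set [0,1,2]. holonomy sheet_perm (map set p) i = sheet_perm (T \<inter> U) i"
    using p(2) unfolding path_ok_def Let_def t by auto
  have "successively (\<lambda>P Q. dual_adjacent knotted_ball P Q \<and> f \<subset> P \<inter> Q \<and> P \<inter> Q \<noteq> T \<inter> U) (map set p)"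
    unfolding successively_map
  proof (rule successively_mono[OF succ])
    fix P Q assume "P \<in> set p" "Q \<in> set p" and PQ: "card (set P \<inter> set Q) = 3 \<and> set g \<subseteq> set P \<inter> set Q
      \<and> set P \<inter> set Q \<noteq> T \<inter> U"
    moreover have "f \<noteq> set P \<inter> set Q" using PQ f(2) by auto
    ultimately show "dual_adjacent knotted_ball (set P) (set Q) \<and> f \<subset> set P \<inter> set Q \<and> set P \<inter> set Q \<noteq> T \<inter> U"
      using p(1) g(2) by (auto intro: dual_adjacent_set)
  qed
  moreover have "\<exists>i<3. holonomy sheet_perm (map set p) i = sheet_perm (T \<inter> U) i"
    using hol unfolding less_3_iff by (auto split: if_splits)
  \<comment> \<open>The order \<open>u < v\<close> turns equality of vertex sets into equality of
    lists, on which \<open>path_ok\<close> branches.\<close>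
  moreover have "g = knotted_edge" if "f = set knotted_edge"
    using that uv(2,3) by (auto simp: g_def knotted_edge_def doubleton_eq_iff)
  then have "\<forall>i<3. f \<noteq> set knotted_edge \<longrightarrow> holonomy sheet_perm (map set p) i = sheet_perm (T \<inter> U) i"
    using hol g(2) unfolding less_3_iff by (auto split: if_splits)
  moreover have "hd (map set p) = T \<and> last (map set p) = U \<or> hd (map set p) = U \<and> last (map set p) = T"
    using p(3,4) kl by (auto simp: hd_map last_map)
  ultimately show "\<exists>p. p \<noteq> [] \<and> (hd p = T \<and> last p = U \<or> hd p = U \<and> last p = T) \<and>
         successively (\<lambda>P Q. dual_adjacent knotted_ball P Q \<and> f \<subset> P \<inter> Q \<and> P \<inter> Q \<noteq> T \<inter> U) p \<and>
         (\<forall>i<3. f \<noteq> set knotted_edge \<longrightarrow> holonomy sheet_perm p i = sheet_perm (T \<inter> U) i) \<and>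
         (\<exists>i<3. holonomy sheet_perm p i = sheet_perm (T \<inter> U) i)"
    using p(3) by (intro exI[of _ "map set p"]) simp
next
  show "\<exists>p. p \<noteq> [] \<and> hd p = last p \<and> successively (dual_adjacent knotted_ball) p \<and>
         (\<forall>i<3. holonomy sheet_perm p i \<noteq> i)"
  proof (intro exI[of _ "map set monodromy_walk"] conjI)
    note w = monodromy_walk
    show "map set monodromy_walk \<noteq> []" using w by simp
    show "hd (map set monodromy_walk) = last (map set monodromy_walk)"
      using w by (simp add: hd_map last_map)
    show "successively (dual_adjacent knotted_ball) (map set monodromy_walk)"
      unfolding successively_map
    proof (rule successively_mono)
      show "successively (\<lambda>P Q. card (set P \<inter> set Q) = 3) monodromy_walk" using w by blast
    qed (use w in \<open>auto intro: dual_adjacent_set\<close>)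
    show "\<forall>i<3. holonomy sheet_perm (map set monodromy_walk) i \<noteq> i"
      using w unfolding less_3_iff by blast
  qed
qed

theorem corollary3p24:
  "\<exists>B :: nat set set. simplicial_3_ball B \<and> collapsible B \<and>
     (\<forall>\<sigma>\<in>facets (boundary_complex B). \<not> collapses_onto B (boundary_complex B - {\<sigma>}))"
proof (intro exI conjI ballI)
  have "list_complex [[2, 0, 1, 3]] = generated {{2, 0, 1, 3 :: nat}}"
    by (simp add: list_complex_def)
  then have "underlying_space (list_complex [[2, 0, 1, 3 :: nat]]) homeomorphic (cball 0 1 :: (real ^ 3) set)"
    using simplex_homeomorphic_cball[of "{2, 0, 1, 3 :: nat}", where 'b = "real ^ 3"] by simp
  then show "simplicial_3_ball knotted_ball"
    unfolding simplicial_3_ball_def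
    using complex flips_homeomorphic[OF flips] homeomorphic_trans by blast
  show "collapsible knotted_ball"
    unfolding collapsible_def using collapse_steps_collapses_onto[OF collapse_ok] by blast
  show "\<not> collapses_onto knotted_ball (boundary_complex knotted_ball - {\<sigma>})" if "\<sigma> \<in> facets (boundary_complex knotted_ball)" for \<sigma>
    using that by (rule not_collapses_onto_boundary_minus_facet)
qed

end
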